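(* Let $\Psi\in\mathbb{S}_+(\mathbb{T})$ be rational, let $G(z)=(zI-A)^{-1}B$ be a filter bank with $I\in\mathrm{Range}\,\Gamma$, and let $\Lambda\in\mathrm{Range}\,\Gamma$ be a fixed matrix (so $\|\Lambda\|<\infty$). For integers $\nu>1$ put $$\Phi_\nu(\Lambda)=\frac{\Psi}{\left(1+\frac1\nu G^*\Lambda G\right)^{\nu}},$$ which is well defined on $\mathbb{T}$ for all $\nu$ large enough, and put $$\Phi_\infty(\Lambda)=e^{\log(\Psi)-G^*\Lambda G}=\Psi\, e^{-G^*\Lambda G}.$$ Then $\Phi_\nu(\Lambda)$ converges to $\Phi_\infty(\Lambda)$ uniformly on $\mathbb{T}$ as $\nu\to\infty$.
   Context: $\mathbb{T}$ is the unit circle; integrals $\int$ without limits are over $\vartheta\in[-\pi,\pi)$ with respect to $d\vartheta/2\pi$, the integrand being evaluated at $z=e^{j\vartheta}$. $\mathbb{S}_+(\mathbb{T})$ is the set of spectral densities on $\mathbb{T}$ (of real-valued scalar stationary processes) that are bounded and coercive, i.e. measurable real functions $\Phi$ with $\Phi(e^{-j\vartheta})=\Phi(e^{j\vartheta})$ and $\mu\leq\Phi\leq M$ on $\mathbb{T}$ for some constants $0<\mu\leq M<\infty$. "Rational" means being the restriction to $\mathbb{T}$ of a rational function of $z$. Filter bank: $A\in\mathbb{R}^{n\times n}$ has all eigenvalues in the open unit disc, $B\in\mathbb{R}^n$, $(A,B)$ is reachable, $n>1$. On $\mathbb{T}$, $G^*$ is the conjugate transpose of $G$. $\mathcal{Q}_n$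 is the space of real symmetric $n\times n$ matrices. $\Gamma$ is the linear operator $\Phi\mapsto\int G\Phi G^*$ from the real linear span of $\mathbb{S}_+(\mathbb{T})$ to $\mathcal{Q}_n$, and $\mathrm{Range}\,\Gamma\subseteq\mathcal{Q}_n$ is its range. *)

theory Defs
  imports "HOL-Analysis.Analysis" "HOL-Computational_Algebra.Polynomial"
begin

abbreviation unit_circle :: "complex set" where
  "unit_circle \<equiv> sphere 0 1"

text \<open>Functions on the unit circle are represented by functions on the complex plane of which
  only the values on the circle matter.\<close>

definition spectral_densities :: "(complex \<Rightarrow> real) set" where
  "spectral_densities = {\<Phi>.
     (\<lambda>\<theta>. \<Phi> (cis \<theta>)) \<in> borel_measurable (lebesgue_on {-pi..<pi}) \<and>
     (\<forall>\<theta>. \<Phi> (cis (- \<theta>)) = \<Phi> (cis \<theta>)) \<and>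
     (\<exists>\<mu> M. 0 < \<mu> \<and> \<mu> \<le> M \<and> (\<forall>z\<in>unit_circle. \<mu> \<le> \<Phi> z \<and> \<Phi> z \<le> M))}"

definition span_spectral_densities :: "(complex \<Rightarrow> real) set" where
  "span_spectral_densities = {\<Phi>. \<exists>S c. finite S \<and> S \<subseteq> spectral_densities \<and>
     \<Phi> = (\<lambda>z. \<Sum>\<phi>\<in>S. c \<phi> * \<phi> z)}"

definition rational_on_circle :: "(complex \<Rightarrow> real) \<Rightarrow> bool" where
  "rational_on_circle \<Phi> \<longleftrightarrow> (\<exists>p q :: complex poly. \<forall>z\<in>unit_circle.
     poly q z \<noteq> 0 \<and> complex_of_real (\<Phi> z) = poly p z / poly q z)"

definition complex_vec :: "real ^ 'n \<Rightarrow> complex ^ 'n" where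
  "complex_vec v = (\<chi> i. complex_of_real (v $ i))"

definition complex_mat :: "real ^ 'n ^ 'n \<Rightarrow> complex ^ 'n ^ 'n" where
  "complex_mat A = map_matrix complex_of_real A"

definition eigenvalue_of :: "real ^ 'n ^ 'n \<Rightarrow> complex \<Rightarrow> bool" where
  "eigenvalue_of A \<mu> \<longleftrightarrow> (\<exists>v. v \<noteq> 0 \<and> complex_mat A *v v = \<mu> *s v)"

text \<open>Every state of \<open>x(t+1) = A x(t) + B u(t)\<close> can be reached from the origin in finite time.\<close>

definition reachable :: "real ^ 'n ^ 'n \<Rightarrow> real ^ 'n \<Rightarrow> bool" where
  "reachable A B \<longleftrightarrow> (\<forall>\<xi>. \<exists>(u :: nat \<Rightarrow> real) (x :: nat \<Rightarrow> real ^ 'n) N.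
     x 0 = 0 \<and> (\<forall>t. x (Suc t) = A *v x t + u t *\<^sub>R B) \<and> x N = \<xi>)"

definition filter_bank :: "real ^ 'n ^ 'n \<Rightarrow> real ^ 'n \<Rightarrow> bool" where
  "filter_bank A B \<longleftrightarrow> (\<forall>\<mu>. eigenvalue_of A \<mu> \<longrightarrow> cmod \<mu> < 1) \<and> reachable A B"

definition transfer :: "real ^ 'n ^ 'n \<Rightarrow> real ^ 'n \<Rightarrow> complex \<Rightarrow> complex ^ 'n" where
  "transfer A B z = matrix_inv (mat z - complex_mat A) *v complex_vec B"

definition Gamma_op :: "real ^ 'n ^ 'n \<Rightarrow> real ^ 'n \<Rightarrow> (complex \<Rightarrow> real) \<Rightarrow> complex ^ 'n ^ 'n" where
  "Gamma_op A B \<Phi> = (1 / (2 * pi)) *\<^sub>R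
     (LINT \<theta> | lebesgue_on {-pi..<pi}. (\<chi> i j.
        transfer A B (cis \<theta>) $ i * complex_of_real (\<Phi> (cis \<theta>)) * cnj (transfer A B (cis \<theta>) $ j)))"

text \<open>The integral above is formed over the complex numbers; by the symmetry of \<open>\<Phi>\<close> its value is
  a real symmetric matrix, and the range is taken as a set of such matrices.\<close>

definition range_Gamma :: "real ^ 'n ^ 'n \<Rightarrow> real ^ 'n \<Rightarrow> (real ^ 'n ^ 'n) set" where
  "range_Gamma A B = {\<Lambda>. transpose \<Lambda> = \<Lambda> \<and>
     (\<exists>\<Phi>\<in>span_spectral_densities. complex_mat \<Lambda> = Gamma_op A B \<Phi>)}"

text \<open>The scalar \<open>G\<^sup>* \<Lambda> G\<close>. It is kept as a complex number, although it is real for symmetric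
  \<open>\<Lambda>\<close>; accordingly the densities below are complex-valued functions with real values.\<close>

definition quad_form :: "real ^ 'n ^ 'n \<Rightarrow> real ^ 'n \<Rightarrow> real ^ 'n ^ 'n \<Rightarrow> complex \<Rightarrow> complex" where
  "quad_form A B \<Lambda> z =
     (\<Sum>i\<in>UNIV. cnj (transfer A B z $ i) * (complex_mat \<Lambda> *v transfer A B z) $ i)"

lemma quad_form_real:
  fixes A \<Lambda> :: "real ^ 'n ^ 'n"
  assumes "transpose \<Lambda> = \<Lambda>"
  shows "quad_form A B \<Lambda> z \<in> \<real>"
proof -
  let ?G = "transfer A B z"
  have sym: "\<Lambda> $ i $ j = \<Lambda> $ j $ i" for i j
    using assms by (metis transpose_def vec_lambda_beta)
  have expand: "quad_form A B \<Lambda> z =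
      (\<Sum>i\<in>UNIV. \<Sum>j\<in>UNIV. cnj (?G $ i) * (complex_of_real (\<Lambda> $ i $ j) * ?G $ j))"
    by (simp add: quad_form_def complex_mat_def matrix_vector_mult_def sum_distrib_left)
  have "cnj (quad_form A B \<Lambda> z) =
      (\<Sum>i\<in>UNIV. \<Sum>j\<in>UNIV. ?G $ i * (complex_of_real (\<Lambda> $ i $ j) * cnj (?G $ j)))"
    by (simp add: expand)
  also have "\<dots> = (\<Sum>j\<in>UNIV. \<Sum>i\<in>UNIV. ?G $ i * (complex_of_real (\<Lambda> $ i $ j) * cnj (?G $ j)))"
    by (rule sum.swap)
  also have "\<dots> = quad_form A B \<Lambda> z"
    unfolding expand by (intro sum.cong refl, subst sym) (simp only: mult_ac)
  finally show ?thesis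
    by (simp add: Reals_cnj_iff)
qed

definition Phi_nu :: "(complex \<Rightarrow> real) \<Rightarrow> real ^ 'n ^ 'n \<Rightarrow> real ^ 'n \<Rightarrow> real ^ 'n ^ 'n \<Rightarrow>
    nat \<Rightarrow> complex \<Rightarrow> complex" where
  "Phi_nu \<Psi> A B \<Lambda> \<nu> z =
     complex_of_real (\<Psi> z) / (1 + 1 / of_nat \<nu> * quad_form A B \<Lambda> z) ^ \<nu>"

definition Phi_inf :: "(complex \<Rightarrow> real) \<Rightarrow> real ^ 'n ^ 'n \<Rightarrow> real ^ 'n \<Rightarrow> real ^ 'n ^ 'n \<Rightarrow>
    complex \<Rightarrow> complex" where
  "Phi_inf \<Psi> A B \<Lambda> z = exp (complex_of_real (ln (\<Psi> z)) - quad_form A B \<Lambda> z)"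

lemma Phi_inf_eq:
  assumes "\<Psi> \<in> spectral_densities" and "z \<in> unit_circle"
  shows "Phi_inf \<Psi> A B \<Lambda> z = complex_of_real (\<Psi> z) * exp (- quad_form A B \<Lambda> z)"
proof -
  have "0 < \<Psi> z"
    using assms unfolding spectral_densities_def by force
  then have "exp (complex_of_real (ln (\<Psi> z))) = complex_of_real (\<Psi> z)"
    by (simp add: exp_of_real)
  then show ?thesis
    by (simp add: Phi_inf_def exp_diff exp_minus field_simps)
qed

end

theory Submission
  imports Defs
begin

text \<open>The transfer function is continuous on the compact circle, so the quadratic form is bounded
  there. The claim is then the locally uniform convergence \<open>(1 + w/n)\<^sup>n \<rightarrow> exp w\<close>, obtained by
  writing the power as \<open>exp (n * ln (1 + w/n))\<close> and expanding the logarithm to first order.\<close>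

text \<open>With \<open>w = f x / n\<close>, the logarithm differs from its linear term by O(|w|^2),
  hence by O(K^2/n^2). Multiplying by \<open>n\<close> leaves O(K^2/n), a bound independent of
  \<open>x\<close>.\<close>

lemma uniform_limit_ln_one_plus:
  fixes f :: "'a \<Rightarrow> complex"
  assumes K: "\<And>x. x \<in> S \<Longrightarrow> norm (f x) \<le> K"
  shows "uniform_limit S (\<lambda>n x. of_nat n * ln (1 + f x / of_nat n)) f sequentially"
proof (rule uniform_limitI)
  fix e :: real assume "e > 0"
  \<comment> \<open>The bound \<open>2 * K\<close> forces |w| < 1/2, so that 1 - |w| can be replaced
    by 1/2 below; the bound \<open>2 * K\<^sup>2 / e\<close> makes the resulting error
    \<open>2 * K\<^sup>2 / n\<close> smaller than \<open>e\<close>.\<close>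
  have "\<forall>\<^sub>F n in sequentially. real n > max (max 1 (2 * K)) (2 * K\<^sup>2 / e)"
    using filterlim_real_sequentially by (simp only: filterlim_at_top_dense)
  then show "\<forall>\<^sub>F n in sequentially. \<forall>x\<in>S. dist (of_nat n * ln (1 + f x / of_nat n)) (f x) < e"
  proof eventually_elim
    case (elim n)
    show ?case
    proof
      fix x assume "x \<in> S"
      define w where "w = f x / of_nat n"
      have n: "real n > 0" "real n > 2 * K" "real n * e > 2 * K\<^sup>2"
        using elim \<open>e > 0\<close> by (simp_all add: pos_divide_less_eq)
      have fx: "f x = of_nat n * w"
        using n by (auto simp: w_def)
      have "norm w \<le> K / n"
        using K[OF \<open>x \<in> S\<close>] n by (simp add: w_def norm_divide divide_right_mono)
      moreover have "K / n < 1/2"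
        using n by (simp add: field_simps)
      ultimately have w: "norm w \<le> K / n" "norm w < 1/2"
        by linarith+
      have "norm (ln (1 + w) - w) \<le> norm w ^ 2 / (1 - norm w)"
        using w by (intro Ln_approx_linear) auto
      also have "\<dots> \<le> norm w ^ 2 / (1/2)"
        using w by (intro divide_left_mono) auto
      also have "\<dots> \<le> (K / n)\<^sup>2 / (1/2)"
        using w by (intro divide_right_mono power_mono) auto
      finally have "real n * norm (ln (1 + w) - w) \<le> real n * ((K / n)\<^sup>2 / (1/2))"
        by (intro mult_left_mono) auto
      also have "\<dots> = 2 * K\<^sup>2 / n"
        using n by (simp add: field_simps power2_eq_square)
      also have "\<dots> < e"
        using n by (simp add: field_simps)
      finally have "norm (of_nat n * (ln (1 + w) - w)) < e"
        by (simp add: norm_mult)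
      then show "dist (of_nat n * ln (1 + f x / of_nat n)) (f x) < e"
        unfolding w_def[symmetric] by (simp add: fx dist_norm right_diff_distrib)
    qed
  qed
qed

text \<open>Once \<open>n\<close> exceeds \<open>K\<close>, the perturbation of 1 has norm below 1
  and cannot equal -1. This serves twice: to undo the logarithm by \<open>exp\<close>, and to show
  that the densities are well defined.\<close>

lemma eventually_one_plus_over_nonzero:
  fixes f :: "'a \<Rightarrow> complex"
  assumes K: "\<And>x. x \<in> S \<Longrightarrow> norm (f x) \<le> K"
  shows "\<forall>\<^sub>F n in sequentially. \<forall>x\<in>S. 1 + f x / of_nat n \<noteq> 0"
proof -
  have "\<forall>\<^sub>F n in sequentially. real n > max 0 K"
    using filterlim_real_sequentially by (simp only: filterlim_at_top_dense)
  then show ?thesis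
  proof eventually_elim
    case (elim n)
    show ?case
    proof
      fix x assume "x \<in> S"
      then have "norm (f x / of_nat n) < 1"
        using K[of x] elim by (simp add: norm_divide)
      then show "1 + f x / of_nat n \<noteq> 0"
        by (metis add_eq_0_iff less_irrefl norm_minus_cancel norm_one)
    qed
  qed
qed

lemma uniform_limit_inverse_exp:
  fixes f :: "'a \<Rightarrow> complex"
  assumes K: "\<And>x. x \<in> S \<Longrightarrow> norm (f x) \<le> K"
  shows "uniform_limit S (\<lambda>n x. inverse ((1 + f x / of_nat n) ^ n)) (\<lambda>x. exp (- f x)) sequentially"
proof -
  let ?g = "\<lambda>n x. - (of_nat n * ln (1 + f x / of_nat n))"
  have lim: "uniform_limit S ?g (\<lambda>x. - f x) sequentially"
    using uniform_limit_ln_one_plus[of S f K] K by (intro uniform_limit_uminus) auto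
  \<comment> \<open>The function \<open>exp\<close> is not uniformly continuous on the whole plane.
    Being eventually within 1 of the limit keeps all values in one compact ball, where it
    is.\<close>
  have "\<forall>\<^sub>F n in sequentially. \<forall>x\<in>S. ?g n x \<in> cball 0 (K + 1)"
    using uniform_limitD[OF lim zero_less_one]
  proof eventually_elim
    case (elim n)
    show ?case
    proof
      fix x assume "x \<in> S"
      have "norm (?g n x) \<le> norm (- f x) + dist (?g n x) (- f x)"
        unfolding dist_norm by (rule norm_triangle_sub)
      also have "\<dots> \<le> K + 1"
        using elim K \<open>x \<in> S\<close> by (intro add_mono) (auto intro: less_imp_le)
      finally show "?g n x \<in> cball 0 (K + 1)"
        by simp
    qed
  qed
  moreover have "uniformly_continuous_on (cball (0::complex) (K + 1)) exp"
    by (intro compact_uniformly_continuous continuous_intros compact_cball)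
  ultimately have exp: "uniform_limit S (\<lambda>n x. exp (?g n x)) (\<lambda>x. exp (- f x)) sequentially"
    by (intro uniform_limit_compose_uniformly_continuous_on[OF lim _ _ closed_cball])
  \<comment> \<open>The identity exp (ln u) = u requires u to be nonzero. The choice of branch is
    harmless, since the logarithm is multiplied by an integer before exponentiation.\<close>
  have "\<forall>\<^sub>F n in sequentially. \<forall>x\<in>S. 1 + f x / of_nat n \<noteq> 0"
    using K by (rule eventually_one_plus_over_nonzero)
  then have "\<forall>\<^sub>F n in sequentially. \<forall>x\<in>S. exp (?g n x) = inverse ((1 + f x / of_nat n) ^ n)"
    by eventually_elim (simp add: exp_minus exp_of_nat_mult)
  then show ?thesis
    by (rule uniform_limit_cong[THEN iffD1, OF _ refl exp])
qed

lemma continuous_on_det: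
  fixes M :: "'a::topological_space \<Rightarrow> 'b::real_normed_field ^ 'n ^ 'n"
  assumes "\<And>i j. continuous_on S (\<lambda>x. M x $ i $ j)"
  shows "continuous_on S (\<lambda>x. det (M x))"
  unfolding det_def by (intro continuous_intros assms)

text \<open>By Cramer's rule each component is a quotient of determinants, which are polynomials in
  the entries, and the denominator does not vanish.\<close>

lemma continuous_on_matrix_inv_mult:
  fixes M :: "'a::topological_space \<Rightarrow> 'b::real_normed_field ^ 'n ^ 'n"
  assumes cont: "\<And>i j. continuous_on S (\<lambda>x. M x $ i $ j)"
    and inv: "\<And>x. x \<in> S \<Longrightarrow> invertible (M x)"
  shows "continuous_on S (\<lambda>x. matrix_inv (M x) *v b)"
proof -
  have det: "det (M x) \<noteq> 0" if "x \<in> S" for x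
    using inv[OF that] by (simp add: invertible_det_nz)
  have "matrix_inv (M x) *v b = (\<chi> k. det (\<chi> i j. if j = k then b $ i else M x $ i $ j) / det (M x))"
    if "x \<in> S" for x
  proof -
    have "M x ** matrix_inv (M x) = mat 1"
      \<comment> \<open>\<open>matrix_inv\<close> is a Hilbert choice, so its defining property has
        to be extracted from the existence of an inverse.\<close>
      using inv[OF that] by (simp add: matrix_inv_def invertible_def) (metis (mono_tags, lifting) someI_ex)
    then have "M x *v (matrix_inv (M x) *v b) = b"
      by (simp add: matrix_vector_mul_assoc)
    then show ?thesis
      by (simp add: cramer[OF det[OF that]])
  qed
  moreover have "continuous_on S
      (\<lambda>x. \<chi> k. det (\<chi> i j. if j = k then b $ i else M x $ i $ j) / det (M x))"
  proof (intro continuous_on_vec_lambda continuous_on_divide continuous_on_det cont ballI det)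
    fix i j k :: 'n
    show "continuous_on S (\<lambda>x. (\<chi> i j. if j = k then b $ i else M x $ i $ j) $ i $ j)"
      using cont by (cases "j = k") simp_all
  qed
  ultimately show ?thesis
    by (simp cong: continuous_on_cong)
qed

text \<open>A nonzero kernel vector of zI - A would be an eigenvector of A for z; a square matrix
  with trivial kernel is invertible.\<close>

lemma invertible_resolvent:
  assumes "\<not> eigenvalue_of A z"
  shows "invertible (mat z - complex_mat A)"
proof -
  have mat: "mat z *v v = z *s v" for v :: "complex ^ 'n"
    by (simp add: vec_eq_iff matrix_vector_mult_def mat_def if_distrib[of "\<lambda>x. x * _"] cong: if_cong)
  have "v = 0" if "(mat z - complex_mat A) *v v = 0" for v
  proof -
    have "complex_mat A *v v = z *s v"
      using that by (simp add: matrix_vector_mult_diff_rdistrib mat)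
    then show ?thesis
      using assms by (auto simp: eigenvalue_of_def)
  qed
  then show ?thesis
    by (simp add: invertible_left_inverse matrix_left_invertible_ker)
qed

lemma continuous_on_transfer:
  assumes "\<And>z. z \<in> S \<Longrightarrow> \<not> eigenvalue_of A z"
  shows "continuous_on S (transfer A B)"
  unfolding transfer_def
proof (intro continuous_on_matrix_inv_mult invertible_resolvent assms)
  show "continuous_on S (\<lambda>z. (mat z - complex_mat A) $ i $ j)" for i j
    by (cases "i = j") (auto simp: mat_def intro!: continuous_intros)
qed

lemma continuous_on_quad_form:
  assumes "continuous_on S (transfer A B)"
  shows "continuous_on S (quad_form A B \<Lambda>)"
  unfolding quad_form_def matrix_vector_mult_def
  by (simp, intro continuous_intros assms)

theorem proposition7p1:
  fixes \<Psi> :: "complex \<Rightarrow> real"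
    and A :: "real ^ 'n ^ 'n" and B :: "real ^ 'n" and \<Lambda> :: "real ^ 'n ^ 'n"
  assumes "CARD('n) > 1"
    and "\<Psi> \<in> spectral_densities" and "rational_on_circle \<Psi>"
    and "filter_bank A B" and "mat 1 \<in> range_Gamma A B"
    and "\<Lambda> \<in> range_Gamma A B"
  shows "(\<forall>\<^sub>F \<nu> in sequentially. \<forall>z\<in>unit_circle.
            1 + 1 / of_nat \<nu> * quad_form A B \<Lambda> z \<noteq> 0) \<and>
         uniform_limit unit_circle (Phi_nu \<Psi> A B \<Lambda>) (Phi_inf \<Psi> A B \<Lambda>) sequentially"
proof -
  let ?q = "quad_form A B \<Lambda>"
  \<comment> \<open>Stability puts the spectrum in the open disc, so the transfer function has no
    poles on the circle.\<close>
  have "\<not> eigenvalue_of A z" if "z \<in> unit_circle" for z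
    using that assms(4) by (auto simp: filter_bank_def)
  then have cont: "continuous_on unit_circle ?q"
    by (intro continuous_on_quad_form continuous_on_transfer)
  have "bounded (?q ` unit_circle)"
    by (intro compact_imp_bounded compact_continuous_image cont compact_sphere)
  then obtain K where K: "\<And>z. z \<in> unit_circle \<Longrightarrow> norm (?q z) \<le> K"
    unfolding bounded_iff by blast
  have nz: "\<forall>\<^sub>F \<nu> in sequentially. \<forall>z\<in>unit_circle. 1 + ?q z / of_nat \<nu> \<noteq> 0"
    using K by (rule eventually_one_plus_over_nonzero)
  obtain M where M: "\<And>z. z \<in> unit_circle \<Longrightarrow> \<bar>\<Psi> z\<bar> \<le> M"
    using assms(2) unfolding spectral_densities_def by fastforce
  have inverse: "uniform_limit unit_circle
      (\<lambda>\<nu> z. inverse ((1 + ?q z / of_nat \<nu>) ^ \<nu>)) (\<lambda>z. exp (- ?q z)) sequentially"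
    using K by (rule uniform_limit_inverse_exp)
  have lim: "uniform_limit unit_circle
      (\<lambda>\<nu> z. of_real (\<Psi> z) * inverse ((1 + ?q z / of_nat \<nu>) ^ \<nu>))
      (\<lambda>z. of_real (\<Psi> z) * exp (- ?q z)) sequentially"
  \<comment> \<open>A product of uniform limits is uniform when both limit functions are bounded:
    here the density by \<open>M\<close>, and the exponential by compactness of the circle.\<close>
  proof (intro uniform_lim_mult uniform_limit_const inverse)
    show "bounded ((\<lambda>z. complex_of_real (\<Psi> z)) ` unit_circle)"
      using M by (intro boundedI[of _ M]) auto
    show "bounded ((\<lambda>z. exp (- ?q z)) ` unit_circle)"
      by (intro compact_imp_bounded compact_continuous_image continuous_intros cont compact_sphere)
  qed
  have "uniform_limit unit_circle (Phi_nu \<Psi> A B \<Lambda>) (Phi_inf \<Psi> A B \<Lambda>) sequentially"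
  proof (rule uniform_limit_cong'[THEN iffD2, OF _ _ lim])
    \<comment> \<open>This holds for every \<open>\<nu>\<close>, even where the denominator
      vanishes, because division is multiplication by the total \<open>inverse\<close>.\<close>
    show "Phi_nu \<Psi> A B \<Lambda> \<nu> z = of_real (\<Psi> z) * inverse ((1 + ?q z / of_nat \<nu>) ^ \<nu>)" for \<nu> z
      by (simp add: Phi_nu_def divide_inverse mult.commute)
  qed (rule Phi_inf_eq[OF assms(2)])
  with nz show ?thesis
    by simp
qed

end
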